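(* Let $n\ge 2$, let $P=(p_1,\dots,p_n)$ and $Q=(q_1,\dots,q_n)$ be elements of $\Gamma_n$, and let $r,R$ be real numbers with $0<r\le \frac{p_i}{q_i}\le R<\infty$ for all $i\in\{1,\dots,n\}$. Then $$\frac{1}{R}\,I(P\|Q)\le G(P\|Q)\le \frac{1}{r}\,I(P\|Q).$$
   Context: $\Gamma_n=\{P=(p_1,\dots,p_n): p_i>0,\ \sum_{i=1}^n p_i=1\}$ is the set of finite discrete probability distributions with strictly positive entries. $\ln$ is the natural logarithm. The relative arithmetic-geometric divergence is $G(P\|Q)=\sum_{i=1}^n \left(\frac{p_i+q_i}{2}\right)\ln\left(\frac{p_i+q_i}{2p_i}\right)$. The Jensen-Shannon divergence is $I(P\|Q)=\frac12\left[\sum_{i=1}^n p_i\ln\left(\frac{2p_i}{p_i+q_i}\right)+\sum_{i=1}^n q_i\ln\left(\frac{2q_i}{p_i+q_i}\right)\right]$. *)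

theory Defs
  imports Complex_Main
begin

text \<open>A point of \<open>\<Gamma>\<^sub>n\<close> is represented by a function on \<open>nat\<close> of which only
  the values at the indices \<open>1, \<dots>, n\<close> are relevant.\<close>

definition prob_dists :: "nat \<Rightarrow> (nat \<Rightarrow> real) set" where
  "prob_dists n = {p. (\<forall>i\<in>{1..n}. p i > 0) \<and> (\<Sum>i=1..n. p i) = 1}"

definition relative_AG_divergence :: "nat \<Rightarrow> (nat \<Rightarrow> real) \<Rightarrow> (nat \<Rightarrow> real) \<Rightarrow> real" where
  "relative_AG_divergence n p q =
     (\<Sum>i=1..n. ((p i + q i) / 2) * ln ((p i + q i) / (2 * p i)))"

definition JS_divergence :: "nat \<Rightarrow> (nat \<Rightarrow> real) \<Rightarrow> (nat \<Rightarrow> real) \<Rightarrow> real" where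
  "JS_divergence n p q =
     (1 / 2) * ((\<Sum>i=1..n. p i * ln (2 * p i / (p i + q i)))
              + (\<Sum>i=1..n. q i * ln (2 * q i / (p i + q i))))"

end

theory Submission
  imports Defs "HOL-Analysis.Convex"
begin

text \<open>Both divergences are Csiszar divergences \<open>\<Sum> q f(p/q)\<close>, and the second derivatives of their
  generators are \<open>1 / (2 x\<^sup>2 (x + 1))\<close> for \<open>G\<close> and \<open>1 / (2 x (x + 1))\<close> for \<open>I\<close>, with ratio \<open>1/x\<close>.
  Hence \<open>G - I/R\<close> has a generator convex on \<open>x \<le> R\<close> and \<open>I/r - G\<close> has one convex on \<open>x \<ge> r\<close>.
  The tangent at \<open>1\<close> bounds each generator from below, and its linear term \<open>\<Sum> (p - q)\<close>
  vanishes after summation.\<close>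

definition AG_gen :: "real \<Rightarrow> real" where
  "AG_gen x = (x + 1) / 2 * ln ((x + 1) / (2 * x))"

definition JS_gen :: "real \<Rightarrow> real" where
  "JS_gen x = (x * ln (2 * x / (x + 1)) + ln (2 / (x + 1))) / 2"

lemma AG_gen_has_real_derivative:
  assumes "x > 0"
  shows "(AG_gen has_real_derivative (ln ((x + 1) / (2 * x)) - 1 / x) / 2) (at x)"
  unfolding AG_gen_def using assms
  by (auto intro!: derivative_eq_intros simp: divide_simps)

lemma AG_gen_deriv_has_real_derivative:
  assumes "x > 0"
  shows "((\<lambda>x. (ln ((x + 1) / (2 * x)) - 1 / x) / 2)
           has_real_derivative 1 / (2 * x\<^sup>2 * (x + 1))) (at x)"
proof -
  have "((\<lambda>x. ln ((x + 1) / (2 * x))) has_real_derivative - (1 / (x * (x + 1)))) (at x)"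
    using assms by (auto intro!: derivative_eq_intros simp: divide_simps)
  moreover have "((\<lambda>x. 1 / x) has_real_derivative - (1 / x\<^sup>2)) (at x)"
    using assms by (auto intro!: derivative_eq_intros simp: power2_eq_square)
  ultimately have "((\<lambda>x. (ln ((x + 1) / (2 * x)) - 1 / x) / 2) has_real_derivative
      (- (1 / (x * (x + 1))) - - (1 / x\<^sup>2)) / 2) (at x)"
    by (intro DERIV_cdivide DERIV_diff)
  also have "(- (1 / (x * (x + 1))) - - (1 / x\<^sup>2)) / 2 = 1 / (2 * x\<^sup>2 * (x + 1))"
    using assms by (simp add: divide_simps power2_eq_square)
  finally show ?thesis .
qed

text \<open>Differentiating the two logarithms contributes
  \<open>x * (1 / x - 1 / (x + 1)) - 1 / (x + 1)\<close>, which is zero, so only the logarithm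
  itself survives.\<close>

lemma JS_gen_has_real_derivative:
  assumes "x > 0"
  shows "(JS_gen has_real_derivative ln (2 * x / (x + 1)) / 2) (at x)"
  unfolding JS_gen_def using assms
  by (auto intro!: derivative_eq_intros simp: divide_simps)

lemma JS_gen_deriv_has_real_derivative:
  assumes "x > 0"
  shows "((\<lambda>x. ln (2 * x / (x + 1)) / 2) has_real_derivative 1 / (2 * x * (x + 1))) (at x)"
  using assms
  by (auto intro!: derivative_eq_intros simp: divide_simps) (simp add: algebra_simps)

text \<open>The condition on \<open>a\<close> and \<open>b\<close> makes the combination convex on
  \<open>C\<close>, and its tangent at \<open>1\<close> is the zero line. Free coefficients let both
  inequalities of the theorem use the same argument.\<close>

lemma gen_combination_nonneg:
  fixes a b x :: real
  assumes C: "convex C" "C \<subseteq> {0<..}" "1 \<in> C" "x \<in> C"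
    and nonneg: "\<And>y. y \<in> C \<Longrightarrow> a / y + b \<ge> 0"
  shows "a * (AG_gen x + (x - 1) / 2) + b * JS_gen x \<ge> 0"
proof -
  define h where "h y = a * (AG_gen y + (y - 1) / 2) + b * JS_gen y" for y
  define h' where "h' y = a * ((ln ((y + 1) / (2 * y)) - 1 / y) / 2 + 1 / 2)
                          + b * (ln (2 * y / (y + 1)) / 2)" for y
  define h'' where "h'' y = a * (1 / (2 * y\<^sup>2 * (y + 1))) + b * (1 / (2 * y * (y + 1)))" for y
  have pos: "y > 0" if "y \<in> C" for y
    using that C(2) by auto
  have "h' 1 * (x - 1) \<le> h x - h 1"
  \<comment> \<open>A nonnegative second derivative on a convex set puts the graph above its
    tangents.\<close>
  proof (rule f''_imp_f'[OF C(1)])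
    fix y assume y: "y \<in> C"
    show "(h has_real_derivative h' y) (at y)"
      unfolding h_def h'_def using pos[OF y]
      by (auto intro!: derivative_eq_intros AG_gen_has_real_derivative JS_gen_has_real_derivative)
    show "(h' has_real_derivative h'' y) (at y)"
      unfolding h'_def h''_def using pos[OF y]
      \<comment> \<open>The instance \<open>E = 0\<close> absorbs the constant summand
        \<open>1 / 2\<close> of \<open>h'\<close>, so no \<open>+ 0\<close> is left in the
        derivative.\<close>
      by (intro DERIV_add DERIV_cmult DERIV_add[where E = 0, simplified] DERIV_const
            AG_gen_deriv_has_real_derivative JS_gen_deriv_has_real_derivative)
    have "h'' y = (a / y + b) / (2 * y * (y + 1))"
      unfolding h''_def using pos[OF y] by (simp add: divide_simps power2_eq_square)
    then show "h'' y \<ge> 0"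
      using nonneg[OF y] pos[OF y] by simp
  qed (use C in auto)
  \<comment> \<open>The slope of \<open>AG_gen\<close> at \<open>1\<close> is \<open>-1/2\<close>,
    cancelled by the added \<open>(y - 1) / 2\<close>; that of \<open>JS_gen\<close> is already
    \<open>0\<close>.\<close>
  moreover have "h 1 = 0" "h' 1 = 0"
    by (simp_all add: h_def h'_def AG_gen_def JS_gen_def)
  ultimately show ?thesis
    by (simp add: h_def)
qed

lemma relative_AG_divergence_eq_gen:
  assumes "p \<in> prob_dists n" "q \<in> prob_dists n"
  shows "relative_AG_divergence n p q = (\<Sum>i=1..n. q i * (AG_gen (p i / q i) + (p i / q i - 1) / 2))"
proof -
  have "(\<Sum>i=1..n. q i * (AG_gen (p i / q i) + (p i / q i - 1) / 2))
        = (\<Sum>i=1..n. (p i + q i) / 2 * ln ((p i + q i) / (2 * p i)) + (p i - q i) / 2)"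
  proof (rule sum.cong)
    fix i assume "i \<in> {1..n}"
    then have "p i > 0" "q i > 0"
      using assms by (auto simp: prob_dists_def)
    \<comment> \<open>Once the arguments of \<open>ln\<close> agree, the logarithm acts as an atom
      and clearing denominators suffices.\<close>
    then have "(p i / q i + 1) / (2 * (p i / q i)) = (p i + q i) / (2 * p i)"
      by (simp add: field_simps)
    then show "q i * (AG_gen (p i / q i) + (p i / q i - 1) / 2)
        = (p i + q i) / 2 * ln ((p i + q i) / (2 * p i)) + (p i - q i) / 2"
      using \<open>q i > 0\<close> unfolding AG_gen_def by (simp add: field_simps)
  qed simp
  also have "\<dots> = relative_AG_divergence n p q"
    using assms
    by (simp add: relative_AG_divergence_def prob_dists_def sum.distrib sum_subtractf
        flip: sum_divide_distrib)
  finally show ?thesis by simp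
qed

lemma JS_divergence_eq_gen:
  assumes "p \<in> prob_dists n" "q \<in> prob_dists n"
  shows "JS_divergence n p q = (\<Sum>i=1..n. q i * JS_gen (p i / q i))"
  unfolding JS_divergence_def sum.distrib[symmetric] sum_distrib_left
proof (rule sum.cong)
  fix i assume "i \<in> {1..n}"
  then have "p i > 0" "q i > 0"
    using assms by (auto simp: prob_dists_def)
  then have "2 * (p i / q i) / (p i / q i + 1) = 2 * p i / (p i + q i)"
    and "2 / (p i / q i + 1) = 2 * q i / (p i + q i)"
    by (simp_all add: field_simps)
  then show "1 / 2 * (p i * ln (2 * p i / (p i + q i)) + q i * ln (2 * q i / (p i + q i)))
      = q i * JS_gen (p i / q i)"
    using \<open>q i > 0\<close> unfolding JS_gen_def by (simp add: field_simps)
qed simp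

lemma divergence_combination_nonneg:
  assumes p: "p \<in> prob_dists n" and q: "q \<in> prob_dists n"
    and C: "convex C" "C \<subseteq> {0<..}" "1 \<in> C"
    and ratio: "\<And>i. i \<in> {1..n} \<Longrightarrow> p i / q i \<in> C"
    and nonneg: "\<And>y. y \<in> C \<Longrightarrow> a / y + b \<ge> 0"
  shows "a * relative_AG_divergence n p q + b * JS_divergence n p q \<ge> 0"
proof -
  have "0 \<le> (\<Sum>i=1..n. q i * (a * (AG_gen (p i / q i) + (p i / q i - 1) / 2)
                              + b * JS_gen (p i / q i)))"
  proof (intro sum_nonneg mult_nonneg_nonneg)
    fix i assume i: "i \<in> {1..n}"
    show "q i \<ge> 0"
      using q i by (auto simp: prob_dists_def less_imp_le)
    show "a * (AG_gen (p i / q i) + (p i / q i - 1) / 2) + b * JS_gen (p i / q i) \<ge> 0"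
      using gen_combination_nonneg[OF C ratio[OF i] nonneg] .
  qed
  also have "\<dots> = a * relative_AG_divergence n p q + b * JS_divergence n p q"
    unfolding relative_AG_divergence_eq_gen[OF p q] JS_divergence_eq_gen[OF p q]
      sum_distrib_left sum.distrib[symmetric]
    by (rule sum.cong) (simp_all only: ring_distribs mult.left_commute)
  finally show ?thesis .
qed

text \<open>Sum \<open>r * q i \<le> p i \<le> R * q i\<close> over all indices; both distributions
  have total mass \<open>1\<close>. This places the tangent point \<open>1\<close> inside
  \<open>{r..R}\<close>.\<close>

lemma prob_dists_ratio_bounds:
  assumes p: "p \<in> prob_dists n" and q: "q \<in> prob_dists n"
    and bounds: "\<And>i. i \<in> {1..n} \<Longrightarrow> r \<le> p i / q i \<and> p i / q i \<le> R"
  shows "r \<le> 1" "1 \<le> R"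
proof -
  have qpos: "q i > 0" if "i \<in> {1..n}" for i
    using q that by (auto simp: prob_dists_def)
  have sums: "(\<Sum>i=1..n. p i) = 1" "(\<Sum>i=1..n. q i) = 1"
    using p q by (auto simp: prob_dists_def)
  have "(\<Sum>i=1..n. r * q i) \<le> (\<Sum>i=1..n. p i)"
    using bounds qpos by (intro sum_mono) (simp add: pos_le_divide_eq)
  then show "r \<le> 1"
    by (simp only: sums mult_1_right flip: sum_distrib_left)
  have "(\<Sum>i=1..n. p i) \<le> (\<Sum>i=1..n. R * q i)"
    using bounds qpos by (intro sum_mono) (simp add: pos_divide_le_eq)
  then show "1 \<le> R"
    by (simp only: sums mult_1_right flip: sum_distrib_left)
qed

theorem proposition6p3:
  fixes n :: nat and p q :: "nat \<Rightarrow> real" and r R :: real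
  assumes "n \<ge> 2"
    and "p \<in> prob_dists n"
    and "q \<in> prob_dists n"
    and "0 < r"
    and "\<And>i. i \<in> {1..n} \<Longrightarrow> r \<le> p i / q i \<and> p i / q i \<le> R"
  shows "(1 / R) * JS_divergence n p q \<le> relative_AG_divergence n p q
       \<and> relative_AG_divergence n p q \<le> (1 / r) * JS_divergence n p q"
proof -
  have C: "convex {r..R}" "{r..R} \<subseteq> {0<..}" "1 \<in> {r..R}"
    using prob_dists_ratio_bounds[OF assms(2,3,5)] \<open>0 < r\<close> by auto
  have ratio: "p i / q i \<in> {r..R}" if "i \<in> {1..n}" for i
    using assms(5)[OF that] by simp
  \<comment> \<open>Here the sign condition \<open>1 / y - 1 / R \<ge> 0\<close> is the upper bound
    \<open>y \<le> R\<close>.\<close>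
  have "1 * relative_AG_divergence n p q + (- (1 / R)) * JS_divergence n p q \<ge> 0"
    by (rule divergence_combination_nonneg[OF assms(2,3) C ratio])
       (use \<open>0 < r\<close> in \<open>auto simp: field_simps\<close>)
  \<comment> \<open>Now the sign condition \<open>1 / r - 1 / y \<ge> 0\<close> is the lower bound
    \<open>r \<le> y\<close>.\<close>
  moreover have "(- 1) * relative_AG_divergence n p q + 1 / r * JS_divergence n p q \<ge> 0"
    by (rule divergence_combination_nonneg[OF assms(2,3) C ratio])
       (use \<open>0 < r\<close> in \<open>auto simp: field_simps\<close>)
  ultimately show ?thesis
    by simp
qed

end
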